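(* Let $1<\alpha<2$ and $1<\beta<2$, and consider the two-person bimatrix game $(\mathbf U,\mathbf V)$ with $$\mathbf U=\begin{pmatrix}2-\alpha & -(\alpha-1) & -\alpha\\ 1 & 0 & -1\\ \beta & \beta-1 & -(2-\beta)\end{pmatrix},\qquad \mathbf V=\begin{pmatrix}2-\alpha & 1 & \beta\\ -(\alpha-1) & 0 & \beta-1\\ -\alpha & -1 & -(2-\beta)\end{pmatrix}.$$ For $\lambda>0$ let $\sigma(\lambda)=\max_{i,j}(\lambda u_{ij}+v_{ij})$, let $\delta(\lambda)=\mathrm{Val}(\lambda\mathbf U-\mathbf V)$, and let $$\boldsymbol\varphi(\lambda)=\Big(\frac{\sigma(\lambda)+\delta(\lambda)}{2\lambda},\frac{\sigma(\lambda)-\delta(\lambda)}{2}\Big).$$ Then the NTU solution of the game based on the lambda transfer approach is obtained at $\lambda^*=1$ and equals $$\boldsymbol\varphi(\lambda^* )=(2-\alpha,\,2-\alpha);$$ that is, $\lambda^*=1$ is the unique $\lambda>0$ for which $\boldsymbol\varphi(\lambda)$ lies on the Pareto optimal boundary of the NTU-feasible set, and $\boldsymbol\varphi(1)=(2-\alpha,2-\alpha)$.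
   Context: For a real matrix $\mathbf M$, $\mathrm{Val}(\mathbf M)$ denotes the minimax value of the two-person zero-sum game with payoff matrix $\mathbf M$ in mixed strategies (the row player maximizes). For a bimatrix game $(\mathbf U,\mathbf V)$, the NTU-feasible set is the convex hull in $\mathbb R^2$ of the payoff pairs $(u_{ij},v_{ij})$ over all pure strategy pairs $(i,j)$; its Pareto optimal boundary is the set of its points $(u,v)$ such that the only point $(u',v')$ of the set with $u'\ge u$ and $v'\ge v$ is $(u,v)$ itself. The NTU solution based on the lambda transfer approach is $\boldsymbol\varphi(\lambda^* )$, where $\lambda^*$ is the unique $\lambda>0$ such that $\boldsymbol\varphi(\lambda)$ is on the Pareto optimal boundary of the NTU-feasible set. *)

theory Defs
  imports "HOL-Analysis.Analysis"
begin

definition mixed :: "(real ^ 'n) set" where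
  "mixed = {p. (\<forall>i. 0 \<le> p $ i) \<and> (\<Sum>i\<in>UNIV. p $ i) = 1}"

text \<open>Rows belong to the maximizing player. Payoffs are bounded over the two simplices, so
  the real-valued \<open>INF\<close> and \<open>SUP\<close> are genuine and attained.\<close>

definition Val :: "real ^ 'n ^ 'm \<Rightarrow> real" where
  "Val M = (INF y\<in>mixed. SUP x\<in>mixed. x \<bullet> (M *v y))"

definition sigma :: "real ^ 'n ^ 'm \<Rightarrow> real ^ 'n ^ 'm \<Rightarrow> real \<Rightarrow> real" where
  "sigma U V l = Max (range (\<lambda>(i, j). l * U $ i $ j + V $ i $ j))"

definition delta :: "real ^ 'n ^ 'm \<Rightarrow> real ^ 'n ^ 'm \<Rightarrow> real \<Rightarrow> real" where
  "delta U V l = Val (l *\<^sub>R U - V)"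

definition phi :: "real ^ 'n ^ 'm \<Rightarrow> real ^ 'n ^ 'm \<Rightarrow> real \<Rightarrow> real \<times> real" where
  "phi U V l = ((sigma U V l + delta U V l) / (2 * l), (sigma U V l - delta U V l) / 2)"

definition ntu_feasible :: "real ^ 'n ^ 'm \<Rightarrow> real ^ 'n ^ 'm \<Rightarrow> (real \<times> real) set" where
  "ntu_feasible U V = convex hull (range (\<lambda>(i, j). (U $ i $ j, V $ i $ j)))"

definition pareto_boundary :: "(real \<times> real) set \<Rightarrow> (real \<times> real) set" where
  "pareto_boundary S =
    {p \<in> S. \<forall>q\<in>S. fst p \<le> fst q \<and> snd p \<le> snd q \<longrightarrow> q = p}"

text \<open>The description is only meaningful when exactly one such parameter exists.\<close>

definition lambda_star :: "real ^ 'n ^ 'm \<Rightarrow> real ^ 'n ^ 'm \<Rightarrow> real" where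
  "lambda_star U V = (THE l. l > 0 \<and> phi U V l \<in> pareto_boundary (ntu_feasible U V))"

definition ntu_solution :: "real ^ 'n ^ 'm \<Rightarrow> real ^ 'n ^ 'm \<Rightarrow> real \<times> real" where
  "ntu_solution U V = phi U V (lambda_star U V)"

end

theory Submission
  imports Defs
begin

text \<open>
  Both payoffs are sums of a row term and a column term. Hence \<open>l U - V\<close> is separable too:
  for every \<open>l > 0\<close> the third row and the third column dominate, so the game has a pure saddle
  point there, and \<open>delta U V l = (2 - \<beta>) (1 - l)\<close>.

  The feasible set lies below the line \<open>u + v = 2 (2 - \<alpha>)\<close>, which it touches at the payoff pair
  \<open>(2 - \<alpha>, 2 - \<alpha>)\<close> of the first row and column. The cell of that pair also gives
  \<open>sigma U V l \<ge> (2 - \<alpha>) (1 + l)\<close>, with equality at \<open>l = 1\<close>. The two components of \<open>phi U V l\<close>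
  therefore add up to
  \[ \frac{(1 + l)\,\sigma + (1 - l)\,\delta}{2 l}
     \ge \frac{(2 - \alpha)(1 + l)^2 + (2 - \beta)(1 - l)^2}{2 l}
     \ge 2 (2 - \alpha), \]
  where the last inequality is strict unless \<open>l = 1\<close>. So \<open>phi U V l\<close> is not even feasible for
  \<open>l \<noteq> 1\<close>, whereas \<open>phi U V 1 = (2 - \<alpha>, 2 - \<alpha>)\<close> maximizes \<open>u + v\<close> over the feasible set and is
  thus Pareto optimal.
\<close>

section \<open>Values of games with a pure saddle point\<close>

lemma mixed_inner_le:
  assumes x: "x \<in> mixed" and z: "\<And>i. z $ i \<le> C"
  shows "x \<bullet> z \<le> C"
proof -
  have "x \<bullet> z = (\<Sum>i\<in>UNIV. x $ i * z $ i)"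
    by (simp add: inner_vec_def)
  also have "\<dots> \<le> (\<Sum>i\<in>UNIV. x $ i * C)"
    using x z by (intro sum_mono mult_left_mono) (auto simp: mixed_def)
  also have "\<dots> = C"
    using x by (simp add: mixed_def flip: sum_distrib_right)
  finally show ?thesis .
qed

lemma mixed_inner_ge:
  assumes "x \<in> mixed" and "\<And>i. C \<le> z $ i"
  shows "C \<le> x \<bullet> z"
  using mixed_inner_le[of x "- z" "- C"] assms by simp

lemma axis_in_mixed: "axis i 1 \<in> mixed"
  by (auto simp: mixed_def axis_def)

lemma Val_eq_saddle_point:
  fixes M :: "real ^ 'n ^ 'm"
  assumes col: "\<And>k. M $ k $ j \<le> M $ i $ j" and row: "\<And>l. M $ i $ j \<le> M $ i $ l"
  shows "Val M = M $ i $ j"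
proof -
  let ?S = "\<lambda>y. SUP x\<in>mixed. x \<bullet> (M *v y)"
  have nonempty: "mixed \<noteq> ({} :: (real ^ 'k) set)"
    using axis_in_mixed by blast
  have bdd: "bdd_above ((\<lambda>x. x \<bullet> (M *v y)) ` mixed)" for y
    by (rule bdd_aboveI2[where M = "norm (M *v y)"], rule mixed_inner_le)
       (auto intro: order_trans[OF abs_ge_self component_le_norm_cart])
  have lower: "M $ i $ j \<le> ?S y" if y: "y \<in> mixed" for y
  proof -
    have "M $ i $ j \<le> y \<bullet> (M $ i)"
      by (rule mixed_inner_ge[OF y row])
    also have "\<dots> = axis i 1 \<bullet> (M *v y)"
      by (simp add: inner_axis' matrix_vector_mul_component inner_commute)
    also have "\<dots> \<le> ?S y"
      by (rule cSUP_upper[OF axis_in_mixed bdd])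
    finally show ?thesis .
  qed
  have upper: "?S (axis j 1) \<le> M $ i $ j"
  proof (rule cSUP_least[OF nonempty])
    fix x :: "real ^ 'm" assume "x \<in> mixed"
    then show "x \<bullet> (M *v axis j 1) \<le> M $ i $ j"
      by (rule mixed_inner_le) (simp add: matrix_vector_mul_component inner_axis col)
  qed
  have "bdd_below (?S ` mixed)"
    using lower by (rule bdd_belowI2)
  then have "Val M \<le> ?S (axis j 1)"
    unfolding Val_def by (rule cINF_lower[OF _ axis_in_mixed])
  moreover have "M $ i $ j \<le> Val M"
    unfolding Val_def using lower by (rule cINF_greatest[OF nonempty])
  ultimately show ?thesis using upper by simp
qed

section \<open>Feasible and Pareto optimal payoff pairs\<close>

lemma sigma_ge: "l * U $ i $ j + V $ i $ j \<le> sigma U V l"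
  unfolding sigma_def by (rule Max_ge) (auto intro: image_eqI[where x = "(i, j)"])

lemma payoff_in_ntu_feasible: "(U $ i $ j, V $ i $ j) \<in> ntu_feasible U V"
  unfolding ntu_feasible_def by (rule hull_inc) (auto intro: image_eqI[where x = "(i, j)"])

lemma ntu_feasible_sum_le:
  assumes cells: "\<And>i j. U $ i $ j + V $ i $ j \<le> c" and p: "p \<in> ntu_feasible U V"
  shows "fst p + snd p \<le> c"
proof -
  let ?H = "{p :: real \<times> real. (1, 1) \<bullet> p \<le> c}"
  have "ntu_feasible U V \<subseteq> ?H"
    unfolding ntu_feasible_def using cells
    by (intro hull_minimal convex_halfspace_le) (auto simp: inner_prod_def)
  with p show ?thesis by (auto simp: inner_prod_def)
qed

lemma pareto_boundary_max_sum:
  assumes "p \<in> S" and "\<And>q. q \<in> S \<Longrightarrow> fst q + snd q \<le> fst p + snd p"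
  shows "p \<in> pareto_boundary S"
  using assms by (force simp: pareto_boundary_def prod_eq_iff)

section \<open>The transfer parameter of the game\<close>

text \<open>
  Multiplied by \<open>2 l\<close>, this says that the lower bound for the component sum of \<open>phi U V l\<close>
  exceeds the maximal feasible sum \<open>2 a\<close>; the difference of the sides is \<open>(a + b) (1 - l)\<^sup>2\<close>.
\<close>

lemma phi_sum_bound:
  fixes a b l :: real
  assumes "0 < a" "0 < b" "l \<noteq> 1"
  shows "4 * l * a < (1 + l) * (a * (1 + l)) + (1 - l) * (b * (1 - l))"
proof -
  have "0 < (a + b) * (1 - l)\<^sup>2"
    using assms by simp
  then show ?thesis
    by (simp add: power2_eq_square algebra_simps)
qed

theorem mainTheorem3:
  fixes \<alpha> \<beta> :: real and U V :: "real ^ 3 ^ 3"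
  assumes "1 < \<alpha>" "\<alpha> < 2" and "1 < \<beta>" "\<beta> < 2"
    and U: "U = vector [vector [2 - \<alpha>, - (\<alpha> - 1), - \<alpha>],
                        vector [1, 0, - 1],
                        vector [\<beta>, \<beta> - 1, - (2 - \<beta>)]]"
    and V: "V = vector [vector [2 - \<alpha>, 1, \<beta>],
                        vector [- (\<alpha> - 1), 0, \<beta> - 1],
                        vector [- \<alpha>, - 1, - (2 - \<beta>)]]"
  shows "(\<forall>l>0. phi U V l \<in> pareto_boundary (ntu_feasible U V) \<longleftrightarrow> l = 1)
    \<and> phi U V 1 = (2 - \<alpha>, 2 - \<alpha>)
    \<and> lambda_star U V = 1
    \<and> ntu_solution U V = (2 - \<alpha>, 2 - \<alpha>)"
proof -
  note entries = U V vector_3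
  have sum_cells: "U $ i $ j + V $ i $ j \<le> 2 * (2 - \<alpha>)" for i j
    using exhaust_3[of i] exhaust_3[of j] assms(1-4) by (auto simp: entries)
  note feasible_sum = ntu_feasible_sum_le[OF sum_cells]
  have delta: "delta U V l = (2 - \<beta>) * (1 - l)" if "l > 0" for l
  proof -
    let ?M = "l *\<^sub>R U - V"
    have scaled: "l < \<alpha> * l" "l < \<beta> * l"
      using that assms(1-4) by auto
    have "Val ?M = ?M $ 3 $ 3"
    proof (rule Val_eq_saddle_point)
      show "?M $ k $ 3 \<le> ?M $ 3 $ 3" for k
        using exhaust_3[of k] that assms(1-4)
        by (auto simp: entries algebra_simps; use scaled in linarith)
      show "?M $ 3 $ 3 \<le> ?M $ 3 $ k" for k
        using exhaust_3[of k] that assms(1-4)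
        by (auto simp: entries algebra_simps; use scaled in linarith)
    qed
    then show ?thesis
      by (simp add: delta_def entries algebra_simps)
  qed
  have sigma_lower: "(2 - \<alpha>) * (1 + l) \<le> sigma U V l" for l
    using sigma_ge[of l U 1 1 V] by (simp add: entries algebra_simps)
  have "sigma U V 1 \<le> 2 * (2 - \<alpha>)"
    unfolding sigma_def using sum_cells by (subst Max_le_iff) auto
  with sigma_lower[of 1] have "sigma U V 1 = 2 * (2 - \<alpha>)"
    by simp
  then have phi_1: "phi U V 1 = (2 - \<alpha>, 2 - \<alpha>)"
    by (simp add: phi_def delta)
  have feasible: "(2 - \<alpha>, 2 - \<alpha>) \<in> ntu_feasible U V"
    using payoff_in_ntu_feasible[of U 1 1 V] by (simp add: entries)
  have pareto_1: "phi U V 1 \<in> pareto_boundary (ntu_feasible U V)"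
    unfolding phi_1
    using feasible by (rule pareto_boundary_max_sum) (use feasible_sum in auto)
  have infeasible: "phi U V l \<notin> ntu_feasible U V" if l: "l > 0" "l \<noteq> 1" for l
  proof
    assume "phi U V l \<in> ntu_feasible U V"
    from feasible_sum[OF this] l
    have "(1 + l) * sigma U V l + (1 - l) * delta U V l \<le> 4 * l * (2 - \<alpha>)"
      by (simp add: phi_def field_simps)
    moreover have "(1 + l) * ((2 - \<alpha>) * (1 + l)) \<le> (1 + l) * sigma U V l"
      using l sigma_lower by (intro mult_left_mono) auto
    moreover have "4 * l * (2 - \<alpha>)
        < (1 + l) * ((2 - \<alpha>) * (1 + l)) + (1 - l) * delta U V l"
      unfolding delta[OF l(1)] using l assms(1-4) by (intro phi_sum_bound) auto
    ultimately show False
      by linarith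
  qed
  have unique: "phi U V l \<in> pareto_boundary (ntu_feasible U V) \<longleftrightarrow> l = 1" if "l > 0" for l
    using that infeasible[of l] pareto_1 by (auto simp: pareto_boundary_def)
  have "lambda_star U V = 1"
    unfolding lambda_star_def by (rule the_equality) (use unique in auto)
  then show ?thesis
    using unique phi_1 by (simp add: ntu_solution_def)
qed

end
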